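(* Let $p$ be a prime, let $G$ be a finite $p$-group, and let $A$ be a finite ordered set of algebra generators for $\mathbb{F}_pG$, all lying in the Jacobson radical $J(\mathbb{F}_pG)$. For every $r\geq 0$, the (images in $\mathbb{F}_pG$ of the) nontips of length at least $r$ with respect to the reverse length-lexicographical ordering $\leq_{\mathrm{RLL}}$ constitute a basis for $J^r(\mathbb{F}_pG)$. Hence the nontips of length exactly $r$ with respect to $\leq_{\mathrm{RLL}}$ are a basis for a complement of $J^{r+1}(\mathbb{F}_pG)$ in $J^r(\mathbb{F}_pG)$.
   Context: $J^r(\mathbb{F}_pG)$ denotes the $r$th power of the Jacobson radical of $\mathbb{F}_pG$, with $J^0=\mathbb{F}_pG$. Let $M$ be the free monoid (with $1$) on $A$, so elements of $M$ are words in the alphabet $A$, and let $\ell(w)$ be the length of a word $w$. The ordering on $A$ induces a lexicographical ordering $\leq_{\mathrm{lex}}$ on $M$. The length-lexicographical ordering is defined by: $w_1\leq_{\mathrm{LL}}w_2$ if $\ell(w_1)<\ell(w_2)$, or $\ell(w_1)=\ell(w_2)$ and $w_1\leq_{\mathrm{lex}}w_2$. The reverse length-lexicographical ordering is its opposite: $w_1\leq_{\mathrm{RLL}}w_2$ if and only if $w_1\geq_{\mathrm{LL}}w_2$. Let $I$ be the kernel of the natural surjection from the free associative unital $\mathbb{F}_p$-algebra on $A$ onto $\mathbb{F}_pG$. A word $w\in M$ is a tip (with respect to a given ordering) if it is the largest word in the support of some nonzero element of $I$; otherwise it is a nontip. Nontips are identified with their images in $\mathbb{F}_pG$ when speaking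 of bases (distinct nontips being counted as distinct members of the family). *)

theory Defs
  imports
    "HOL-Library.Poly_Mapping"
    "Berlekamp_Zassenhaus.Finite_Field"
begin

section \<open>Monoid algebras\<close>

text \<open>
  For a monoid \<open>'g\<close>, written additively, the type \<open>'g \<Rightarrow>\<^sub>0 'k\<close> of finitely supported functions with
  the convolution product of \<^theory>\<open>HOL-Library.Poly_Mapping\<close> is the monoid algebra of \<open>'g\<close> over
  \<open>'k\<close>. The class \<^class>\<open>group_add\<close> is the class of all groups (not necessarily commutative) in
  additive notation, so for \<open>'g :: {finite, group_add}\<close> and \<open>'p :: prime_card\<close> the type
  \<open>'g \<Rightarrow>\<^sub>0 'p mod_ring\<close> is the group algebra of a finite group over the field of integers modulo the
  prime \<open>CARD('p)\<close>.
\<close>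

definition pm_scale :: "'k::field \<Rightarrow> ('x \<Rightarrow>\<^sub>0 'k) \<Rightarrow> ('x \<Rightarrow>\<^sub>0 'k)"
  where "pm_scale c f = Poly_Mapping.map (\<lambda>a. c * a) f"

lemma lookup_pm_scale [simp]: "Poly_Mapping.lookup (pm_scale c f) x = c * Poly_Mapping.lookup f x"
  by (auto simp: pm_scale_def Poly_Mapping.map.rep_eq when_def)

lemma poly_mapping_induct [case_names single sum]:
  fixes f :: "'x \<Rightarrow>\<^sub>0 'k::monoid_add"
  assumes single: "\<And>k v. P (Poly_Mapping.single k v)"
    and sum: "\<And>f g. P f \<Longrightarrow> P g \<Longrightarrow> P (f + g)"
  shows "P f"
proof (induction f rule: update_induct)
  case const
  show ?case using single[of undefined 0] by simp
next
  case (update f a b)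
  have "Poly_Mapping.update a b f = f + Poly_Mapping.single a b"
    by (rule poly_mapping_eqI)
       (use update in \<open>auto simp: lookup_update lookup_add lookup_single in_keys_iff when_def\<close>)
  then show ?case using update single sum by simp
qed

global_interpretation pm: vector_space "pm_scale :: 'k::field \<Rightarrow> ('x \<Rightarrow>\<^sub>0 'k) \<Rightarrow> ('x \<Rightarrow>\<^sub>0 'k)"
  by unfold_locales (rule poly_mapping_eqI; simp add: lookup_add algebra_simps)+

lemma pm_scale_conv_mult:
  "pm_scale c f = Poly_Mapping.single 0 c * f" for f :: "'g::monoid_add \<Rightarrow>\<^sub>0 'k::field"
proof (induction f rule: poly_mapping_induct)
  case (single k v)
  show ?case
    by (rule poly_mapping_eqI) (simp add: mult_single lookup_single when_def)
next
  case (sum f g)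
  then show ?case
    by (simp add: pm.scale_right_distrib distrib_left)
qed

lemma pm_scale_mult_left: "pm_scale c f * g = pm_scale c (f * g)"
  for f g :: "'g::monoid_add \<Rightarrow>\<^sub>0 'k::field"
  by (simp add: pm_scale_conv_mult mult.assoc)

lemma single_zero_commute: "f * Poly_Mapping.single 0 c = Poly_Mapping.single 0 c * f"
  for f :: "'g::monoid_add \<Rightarrow>\<^sub>0 'k::field"
  by (induction f rule: poly_mapping_induct)
     (simp_all add: mult_single distrib_left distrib_right mult.commute)

lemma pm_scale_mult_right: "f * pm_scale c g = pm_scale c (f * g)"
  for f g :: "'g::monoid_add \<Rightarrow>\<^sub>0 'k::field"
proof -
  have "f * pm_scale c g = f * Poly_Mapping.single 0 c * g"
    by (simp add: pm_scale_conv_mult mult.assoc)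
  also have "\<dots> = pm_scale c (f * g)"
    by (simp add: single_zero_commute pm_scale_conv_mult mult.assoc)
  finally show ?thesis .
qed

definition subalgebra :: "('g::monoid_add \<Rightarrow>\<^sub>0 'k::field) set \<Rightarrow> bool"
  where "subalgebra S \<longleftrightarrow> 1 \<in> S \<and> (\<forall>x\<in>S. \<forall>y\<in>S. x + y \<in> S \<and> x * y \<in> S) \<and>
    (\<forall>c. \<forall>x\<in>S. pm_scale c x \<in> S)"

definition generates_algebra :: "('g::monoid_add \<Rightarrow>\<^sub>0 'k::field) set \<Rightarrow> bool"
  where "generates_algebra A \<longleftrightarrow> subalgebra hull A = UNIV"


section \<open>Jacobson radical and powers of ideals\<close>

definition left_ideal :: "'r::ring_1 set \<Rightarrow> bool"
  where "left_ideal L \<longleftrightarrow> 0 \<in> L \<and> (\<forall>x\<in>L. \<forall>y\<in>L. x + y \<in> L) \<and> (\<forall>r. \<forall>x\<in>L. r * x \<in> L)"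

definition maximal_left_ideal :: "'r::ring_1 set \<Rightarrow> bool"
  where "maximal_left_ideal L \<longleftrightarrow> left_ideal L \<and> L \<noteq> UNIV \<and>
    (\<forall>K. left_ideal K \<and> L \<subseteq> K \<longrightarrow> K = L \<or> K = UNIV)"

definition jacobson_radical :: "'r::ring_1 set"
  where "jacobson_radical = \<Inter>{L. maximal_left_ideal L}"

definition ideal_mult :: "'r::ring_1 set \<Rightarrow> 'r set \<Rightarrow> 'r set"
  where "ideal_mult I K =
    {\<Sum>i<n. a i * b i | (n::nat) a b. (\<forall>i<n. a i \<in> I \<and> b i \<in> K)}"

primrec ideal_power :: "'r::ring_1 set \<Rightarrow> nat \<Rightarrow> 'r set"
  where
    "ideal_power I 0 = UNIV"
  | "ideal_power I (Suc r) = ideal_mult I (ideal_power I r)"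


section \<open>Words and the free algebra\<close>

text \<open>
  With concatenation as addition, \<open>'x list\<close> is the free monoid and \<open>'x list \<Rightarrow>\<^sub>0 'k\<close> the free
  associative unital algebra on \<open>'x\<close>. The free algebra on a set \<open>A\<close> consists of those elements all of
  whose words are in \<open>lists A\<close>.
\<close>

instantiation list :: (type) monoid_add
begin

definition zero_list :: "'a list" where "zero_list = []"
definition plus_list :: "'a list \<Rightarrow> 'a list \<Rightarrow> 'a list" where "plus_list xs ys = xs @ ys"

instance by standard (simp_all add: zero_list_def plus_list_def)

end

definition free_algebra :: "'x set \<Rightarrow> ('x list \<Rightarrow>\<^sub>0 'k::field) set"
  where "free_algebra A = {P. Poly_Mapping.keys P \<subseteq> lists A}"

text \<open>
  The letters are elements of the algebra itself, so a word is sent to the product of its letters.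
\<close>

definition natural_map ::
    "(('g::monoid_add \<Rightarrow>\<^sub>0 'k::field) list \<Rightarrow>\<^sub>0 'k) \<Rightarrow> ('g \<Rightarrow>\<^sub>0 'k)"
  where "natural_map P =
    (\<Sum>w\<in>Poly_Mapping.keys P. pm_scale (Poly_Mapping.lookup P w) (prod_list w))"

definition relation_ideal ::
    "('g::monoid_add \<Rightarrow>\<^sub>0 'k::field) set \<Rightarrow> (('g \<Rightarrow>\<^sub>0 'k) list \<Rightarrow>\<^sub>0 'k) set"
  where "relation_ideal A = {P \<in> free_algebra A. natural_map P = 0}"

text \<open>The map above is the algebra homomorphism extending the inclusion of the letters.\<close>

lemma natural_map_superset:
  assumes "finite S" "Poly_Mapping.keys P \<subseteq> S"
  shows "natural_map P = (\<Sum>w\<in>S. pm_scale (Poly_Mapping.lookup P w) (prod_list w))"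
  unfolding natural_map_def
  by (rule sum.mono_neutral_left) (use assms in \<open>auto simp: in_keys_iff\<close>)

lemma natural_map_add: "natural_map (P + Q) = natural_map P + natural_map Q"
proof -
  let ?S = "Poly_Mapping.keys P \<union> Poly_Mapping.keys Q"
  have "Poly_Mapping.keys (P + Q) \<subseteq> ?S"
    by (rule keys_add)
  then show ?thesis
    by (simp add: natural_map_superset[of ?S] lookup_add pm.scale_left_distrib sum.distrib)
qed

lemma natural_map_single: "natural_map (Poly_Mapping.single w c) = pm_scale c (prod_list w)"
  by (simp add: natural_map_superset[of "{w}"])

lemma natural_map_one: "natural_map 1 = 1"
  unfolding single_one[symmetric] natural_map_single by (simp add: zero_list_def)

lemma natural_map_scale: "natural_map (pm_scale c P) = pm_scale c (natural_map P)"
proof -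
  have "Poly_Mapping.keys (pm_scale c P) \<subseteq> Poly_Mapping.keys P"
    by (auto simp: in_keys_iff)
  then show ?thesis
    by (simp add: natural_map_superset[of "Poly_Mapping.keys P"] pm.scale_sum_right)
qed

lemma natural_map_mult: "natural_map (P * Q) = natural_map P * natural_map Q"
proof (induction P rule: poly_mapping_induct)
  case (single u a)
  show ?case
  proof (induction Q rule: poly_mapping_induct)
    case (single v b)
    show ?case
      by (simp add: mult_single natural_map_single plus_list_def
          pm_scale_mult_left pm_scale_mult_right)
  next
    case (sum f g)
    then show ?case
      by (simp add: distrib_left natural_map_add)
  qed
next
  case (sum f g)
  then show ?case
    by (simp add: distrib_right natural_map_add)
qed


section \<open>Orderings on words, tips and nontips\<close>

text \<open>
  An ordering of the alphabet is given as a reflexive relation \<open>R\<close>, whereas \<^const>\<open>lexord\<close> expects a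
  strict relation and yields a strict order.
\<close>

definition lex_le :: "('x \<times> 'x) set \<Rightarrow> 'x list \<Rightarrow> 'x list \<Rightarrow> bool"
  where "lex_le R v w \<longleftrightarrow> v = w \<or> (v, w) \<in> lexord (R - Id)"

definition LL_le :: "('x \<times> 'x) set \<Rightarrow> 'x list \<Rightarrow> 'x list \<Rightarrow> bool"
  where "LL_le R v w \<longleftrightarrow> length v < length w \<or> (length v = length w \<and> lex_le R v w)"

definition RLL_le :: "('x \<times> 'x) set \<Rightarrow> 'x list \<Rightarrow> 'x list \<Rightarrow> bool"
  where "RLL_le R v w \<longleftrightarrow> LL_le R w v"

definition tips ::
    "(('g::monoid_add \<Rightarrow>\<^sub>0 'k::field) list \<Rightarrow> ('g \<Rightarrow>\<^sub>0 'k) list \<Rightarrow> bool) \<Rightarrow>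
      ('g \<Rightarrow>\<^sub>0 'k) set \<Rightarrow> ('g \<Rightarrow>\<^sub>0 'k) list set"
  where "tips leq A = {w. \<exists>P\<in>relation_ideal A. P \<noteq> 0 \<and>
    w \<in> Poly_Mapping.keys P \<and> (\<forall>v\<in>Poly_Mapping.keys P. leq v w)}"

definition nontips ::
    "(('g::monoid_add \<Rightarrow>\<^sub>0 'k::field) list \<Rightarrow> ('g \<Rightarrow>\<^sub>0 'k) list \<Rightarrow> bool) \<Rightarrow>
      ('g \<Rightarrow>\<^sub>0 'k) set \<Rightarrow> ('g \<Rightarrow>\<^sub>0 'k) list set"
  where "nontips leq A = lists A - tips leq A"


section \<open>Bases and complements\<close>

text \<open>
  The images of the words in \<open>N\<close>, as a family indexed by \<open>N\<close>, form a basis of \<open>V\<close>; injectivity says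
  that distinct words count as distinct members.
\<close>

definition words_basis :: "('g::monoid_add \<Rightarrow>\<^sub>0 'k::field) list set \<Rightarrow> ('g \<Rightarrow>\<^sub>0 'k) set \<Rightarrow> bool"
  where "words_basis N V \<longleftrightarrow>
    inj_on prod_list N \<and> pm.independent (prod_list ` N) \<and> pm.span (prod_list ` N) = V"

definition complement_in :: "('x \<Rightarrow>\<^sub>0 'k::field) set \<Rightarrow> ('x \<Rightarrow>\<^sub>0 'k) set \<Rightarrow> ('x \<Rightarrow>\<^sub>0 'k) set \<Rightarrow> bool"
  where "complement_in C U V \<longleftrightarrow>
    pm.subspace C \<and> C \<subseteq> V \<and> C \<inter> U = {0} \<and> V = {c + u | c u. c \<in> C \<and> u \<in> U}"

end

theory Submission
  imports Defs
begin

text \<open>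
  Write \<open>J\<close> for the Jacobson radical of the group algebra. Since the generators lie in \<open>J\<close>, every
  nonempty word has its image in \<open>J\<close>; since they generate, the algebra is the sum of the line through
  \<open>1\<close> and the span of the nonempty words. As \<open>J\<close> does not contain \<open>1\<close>, it is exactly the span of the
  nonempty words, and multiplying out gives that \<open>J\<^sup>r\<close> is the span of the words of length at
  least \<open>r\<close> (\<open>ideal_power_eq_span_words\<close>).

  It remains to thin out this spanning family to the nontips. For any linear ordering of the words the
  nontips are independent, because a linear relation among them is an element of the kernel whose
  largest word would be a tip (\<open>nontips_independent\<close>). They span because a tip can be rewritten as a
  combination of smaller words (\<open>tip_in_span_smaller\<close>). In the reverse length-lexicographical ordering
  a smaller word is at least as long, so rewriting stays within the words of length at least \<open>r\<close>.
  On its own this rewriting could go on forever, through longer and longer words. But \<open>J\<close> is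
  nilpotent (\<open>jacobson_radical_nilpotent\<close>), so all long words vanish and only finitely many words
  have to be rewritten (\<open>word_in_span_nontips\<close>). The complement then comes from splitting the basis of \<open>J\<^sup>r\<close> into
  the nontips of length \<open>r\<close> and the longer ones.
\<close>


section \<open>Ideals and the Jacobson radical of a finite ring\<close>

lemma left_idealD:
  assumes "left_ideal L"
  shows "0 \<in> L" "x \<in> L \<Longrightarrow> y \<in> L \<Longrightarrow> x + y \<in> L" "x \<in> L \<Longrightarrow> r * x \<in> L"
  using assms by (auto simp: left_ideal_def)

lemma left_ideal_sum:
  assumes "left_ideal L" "\<And>i. i \<in> T \<Longrightarrow> f i \<in> L"
  shows "sum f T \<in> L"
  using assms(2)
  by (induction T rule: infinite_finite_induct) (auto intro: left_idealD[OF assms(1)])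

lemma left_ideal_UNIV: "left_ideal UNIV"
  by (simp add: left_ideal_def)

lemma left_ideal_Inter:
  assumes "\<And>L. L \<in> C \<Longrightarrow> left_ideal L"
  shows "left_ideal (\<Inter>C)"
  using assms unfolding left_ideal_def[of "\<Inter>C"] by (auto intro: left_idealD)

lemma left_ideal_jacobson_radical: "left_ideal jacobson_radical"
  unfolding jacobson_radical_def by (rule left_ideal_Inter) (simp add: maximal_left_ideal_def)

lemma ideal_multE:
  fixes I K :: "'r::ring_1 set"
  assumes "x \<in> ideal_mult I K"
  obtains n :: nat and a b :: "nat \<Rightarrow> 'r"
  where "x = (\<Sum>i<n. a i * b i)" "\<forall>i<n. a i \<in> I \<and> b i \<in> K"
  using assms unfolding ideal_mult_def by blast

lemma ideal_mult_zero: "0 \<in> ideal_mult I K"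
  unfolding ideal_mult_def by (rule CollectI, rule exI[of _ 0]) simp

lemma ideal_mult_add_prod:
  assumes "x \<in> ideal_mult I K" "s \<in> I" "t \<in> K"
  shows "x + s * t \<in> ideal_mult I K"
proof -
  obtain n :: nat and a b where x: "x = (\<Sum>i<n. a i * b i)" and ab: "\<forall>i<n. a i \<in> I \<and> b i \<in> K"
    using assms(1) by (rule ideal_multE)
  have "x + s * t = (\<Sum>i<Suc n. (a(n := s)) i * (b(n := t)) i)"
    unfolding x by simp
  moreover have "\<forall>i<Suc n. (a(n := s)) i \<in> I \<and> (b(n := t)) i \<in> K"
    using ab assms(2,3) by (simp add: less_Suc_eq)
  ultimately show ?thesis
    unfolding ideal_mult_def by blast
qed

lemma ideal_mult_prod: "s \<in> I \<Longrightarrow> t \<in> K \<Longrightarrow> s * t \<in> ideal_mult I K"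
  using ideal_mult_add_prod[OF ideal_mult_zero] by fastforce

lemma ideal_mult_add:
  assumes "x \<in> ideal_mult I K" "y \<in> ideal_mult I K"
  shows "x + y \<in> ideal_mult I K"
proof -
  obtain n :: nat and a b where y: "y = (\<Sum>i<n. a i * b i)" and ab: "\<forall>i<n. a i \<in> I \<and> b i \<in> K"
    using assms(2) by (rule ideal_multE)
  have "m \<le> n \<Longrightarrow> x + (\<Sum>i<m. a i * b i) \<in> ideal_mult I K" for m
  proof (induction m)
    case 0
    then show ?case using assms(1) by simp
  next
    case (Suc m)
    then have "x + (\<Sum>i<m. a i * b i) + a m * b m \<in> ideal_mult I K"
      using ab by (intro ideal_mult_add_prod) auto
    then show ?case by (simp add: add.assoc)
  qed
  then show ?thesis unfolding y by blast
qed

lemma left_ideal_ideal_mult: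
  assumes "left_ideal I"
  shows "left_ideal (ideal_mult I K)"
  unfolding left_ideal_def
proof (intro conjI ballI allI)
  fix r x
  assume "x \<in> ideal_mult I K"
  then obtain n :: nat and a b where x: "x = (\<Sum>i<n. a i * b i)" and ab: "\<forall>i<n. a i \<in> I \<and> b i \<in> K"
    by (rule ideal_multE)
  have "r * x = (\<Sum>i<n. (r * a i) * b i)"
    unfolding x by (simp add: sum_distrib_left mult.assoc)
  moreover have "\<forall>i<n. r * a i \<in> I \<and> b i \<in> K"
    using ab left_idealD(3)[OF assms] by blast
  ultimately show "r * x \<in> ideal_mult I K"
    unfolding ideal_mult_def by (intro CollectI exI[of _ n] exI[of _ "\<lambda>i. r * a i"] exI[of _ b]) simp
qed (simp_all add: ideal_mult_zero ideal_mult_add)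

lemma ideal_mult_subset:
  assumes "left_ideal L" "\<And>a b. a \<in> I \<Longrightarrow> b \<in> K \<Longrightarrow> a * b \<in> L"
  shows "ideal_mult I K \<subseteq> L"
  unfolding ideal_mult_def using assms by (auto intro!: left_ideal_sum[OF assms(1)])

lemma left_ideal_ideal_power:
  "left_ideal I \<Longrightarrow> left_ideal (ideal_power I r)"
  by (cases r) (simp_all add: left_ideal_UNIV left_ideal_ideal_mult)

text \<open>
  A form of Nakayama's lemma. For \<open>K\<close> take a left ideal that is maximal among those properly
  contained in \<open>M\<close>, so that the module \<open>M / K\<close> is simple. For each \<open>m\<close> in \<open>M\<close> outside \<open>K\<close> the
  annihilator of its class is then a maximal left ideal. Hence the radical annihilates \<open>M / K\<close>.
\<close>

lemma jacobson_radical_shrinks: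
  fixes M :: "'r::ring_1 set"
  assumes fin: "finite M" and M: "left_ideal M" and nz: "M \<noteq> {0}"
  obtains K where "left_ideal K" "K \<subset> M" "\<And>j m. j \<in> jacobson_radical \<Longrightarrow> m \<in> M \<Longrightarrow> j * m \<in> K"
proof -
  define S where "S = {K. left_ideal K \<and> K \<subset> M}"
  have "finite S"
    by (rule finite_subset[of _ "Pow M"]) (use fin in \<open>auto simp: S_def\<close>)
  moreover have "{0} \<in> S"
    using nz left_idealD(1)[OF M] by (auto simp: S_def left_ideal_def)
  then have "S \<noteq> {}"
    by (metis empty_iff)
  ultimately have "\<exists>K\<in>S. \<forall>K'\<in>S. K \<subseteq> K' \<longrightarrow> K = K'"
    by (rule finite_has_maximal)
  then obtain K where K: "K \<in> S" and max: "\<And>K'. K' \<in> S \<Longrightarrow> K \<subseteq> K' \<Longrightarrow> K = K'"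
    by (elim bexE) (rule that, assumption, metis)
  have lK: "left_ideal K" and KM: "K \<subset> M"
    using K by (auto simp: S_def)
  have JM: "j * m \<in> K" if j: "j \<in> jacobson_radical" and m: "m \<in> M" for j m
  proof (cases "m \<in> K")
    case True
    then show ?thesis by (rule left_idealD(3)[OF lK])
  next
    case False
    define L where "L = {r. r * m \<in> K}"
    have "maximal_left_ideal L"
      unfolding maximal_left_ideal_def
    proof (intro conjI allI impI)
      show "left_ideal L"
        using lK by (simp add: L_def left_ideal_def distrib_right mult.assoc)
      show "L \<noteq> UNIV"
        using False by (metis L_def UNIV_I mem_Collect_eq mult_1)
      fix L'
      assume "left_ideal L' \<and> L \<subseteq> L'"
      then have L': "left_ideal L'" and LL': "L \<subseteq> L'"
        by auto
      show "L' = L \<or> L' = UNIV"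
      proof (cases "L' = L")
        case False
        then obtain x where x: "x \<in> L'" "x * m \<notin> K"
          using LL' by (auto simp: L_def)
        \<comment> \<open>By maximality of \<open>K\<close>, enlarging the annihilator \<open>L\<close> to \<open>L'\<close> forces \<open>L' m + K = M\<close>.\<close>
        define K' where "K' = {l * m + k | l k. l \<in> L' \<and> k \<in> K}"
        have "left_ideal K'"
          unfolding left_ideal_def
        proof (intro conjI ballI allI)
          show "0 \<in> K'"
            using left_idealD(1)[OF L'] left_idealD(1)[OF lK] unfolding K'_def by force
        next
          fix y z assume "y \<in> K'" "z \<in> K'"
          then obtain l k l2 k2 where "y = l * m + k" "z = l2 * m + k2" "l \<in> L'" "k \<in> K" "l2 \<in> L'" "k2 \<in> K"
            unfolding K'_def by blast
          moreover from this have "y + z = (l + l2) * m + (k + k2)"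
            by (simp add: algebra_simps)
          ultimately show "y + z \<in> K'"
            unfolding K'_def using left_idealD(2)[OF L'] left_idealD(2)[OF lK] by blast
        next
          fix r y assume "y \<in> K'"
          then obtain l k where "y = l * m + k" "l \<in> L'" "k \<in> K"
            unfolding K'_def by blast
          moreover from this have "r * y = (r * l) * m + r * k"
            by (simp add: algebra_simps)
          ultimately show "r * y \<in> K'"
            unfolding K'_def using left_idealD(3)[OF L'] left_idealD(3)[OF lK] by blast
        qed
        moreover have "K \<subseteq> K'"
          unfolding K'_def using left_idealD(1)[OF L'] by force
        moreover have "x * m \<in> K'"
          unfolding K'_def using x(1) left_idealD(1)[OF lK] by force
        moreover have "K' \<subseteq> M"
          unfolding K'_def using KM m by (auto intro!: left_idealD(2)[OF M] left_idealD(3)[OF M])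
        ultimately have "K' = M"
          using max[of K'] x(2) by (auto simp: S_def)
        then obtain l k where lk: "m = l * m + k" "l \<in> L'" "k \<in> K"
          using m unfolding K'_def by blast
        have "(1 - l) * m = k"
          using lk(1) by (simp add: algebra_simps)
        then have "1 - l \<in> L'"
          using lk(3) LL' by (auto simp: L_def)
        then have "1 \<in> L'"
          using left_idealD(2)[OF L' _ lk(2)] by fastforce
        then show ?thesis
          using left_idealD(3)[OF L', of 1] by auto
      qed simp
    qed
    then show ?thesis
      using j unfolding jacobson_radical_def L_def by blast
  qed
  show thesis
    by (rule that[OF lK KM JM])
qed

lemma one_notin_jacobson_radical:
  assumes "finite (UNIV :: 'r::ring_1 set)"
  shows "(1 :: 'r) \<notin> jacobson_radical"
proof
  assume one: "(1 :: 'r) \<in> jacobson_radical"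
  have "(UNIV :: 'r set) \<noteq> {0}"
    by (metis UNIV_I singletonD zero_neq_one)
  with assms left_ideal_UNIV show False
  proof (rule jacobson_radical_shrinks)
    fix K :: "'r set"
    assume "K \<subset> UNIV" and K: "\<And>j m. j \<in> jacobson_radical \<Longrightarrow> m \<in> UNIV \<Longrightarrow> j * m \<in> K"
    moreover have "x \<in> K" for x
      using K[OF one, of x] by simp
    ultimately show False by blast
  qed
qed

text \<open>
  As long as a power of the radical is nonzero, the next one is strictly smaller; in a finite ring
  this can happen only finitely often.
\<close>

theorem jacobson_radical_nilpotent:
  assumes "finite (UNIV :: 'r::ring_1 set)"
  obtains N where "ideal_power (jacobson_radical :: 'r set) N = {0}"
proof -
  let ?P = "\<lambda>r. ideal_power (jacobson_radical :: 'r set) r"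
  have fin: "finite X" for X :: "'r set"
    by (rule finite_subset[OF subset_UNIV assms])
  have step: "card (?P (Suc r)) < card (?P r)" if "?P r \<noteq> {0}" for r
  proof -
    have "left_ideal (?P r)"
      by (rule left_ideal_ideal_power[OF left_ideal_jacobson_radical])
    from fin this that show ?thesis
    proof (rule jacobson_radical_shrinks)
      fix K
      assume K: "left_ideal K" "K \<subset> ?P r"
        "\<And>j m. j \<in> jacobson_radical \<Longrightarrow> m \<in> ?P r \<Longrightarrow> j * m \<in> K"
      have "?P (Suc r) \<subseteq> K"
        using ideal_mult_subset[OF K(1,3)] by simp
      then show ?thesis
        using K(2) by (intro psubset_card_mono fin) blast
    qed
  qed
  have "\<exists>N. ?P N = {0}"
  proof (rule ccontr)
    assume "\<nexists>N. ?P N = {0}"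
    then have "card (?P r) + r \<le> card (UNIV :: 'r set)" for r
    proof (induction r)
      case (Suc r)
      with step[of r] show ?case by fastforce
    qed simp
    from this[of "Suc (card (UNIV :: 'r set))"] show False by simp
  qed
  then show thesis
    by (elim exE) (rule that)
qed


section \<open>Powers of the radical as spans of words\<close>

lemma finite_UNIV_poly_mapping:
  "finite (UNIV :: ('x::finite \<Rightarrow>\<^sub>0 'k::{finite, zero}) set)"
proof (rule inj_on_finite)
  show "inj (Poly_Mapping.lookup :: ('x \<Rightarrow>\<^sub>0 'k) \<Rightarrow> _)"
    by (auto intro!: injI poly_mapping_eqI)
qed auto

lemma left_ideal_scale:
  fixes L :: "('g::monoid_add \<Rightarrow>\<^sub>0 'k::field) set"
  shows "left_ideal L \<Longrightarrow> x \<in> L \<Longrightarrow> pm_scale c x \<in> L"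
  by (simp add: pm_scale_conv_mult left_idealD(3))

lemma left_ideal_subspace:
  fixes L :: "('g::monoid_add \<Rightarrow>\<^sub>0 'k::field) set"
  shows "left_ideal L \<Longrightarrow> pm.subspace L"
  unfolding pm.subspace_def by (auto intro: left_idealD left_ideal_scale)

lemma span_mult:
  fixes x y :: "'g::monoid_add \<Rightarrow>\<^sub>0 'k::field"
  assumes "x \<in> pm.span S" "y \<in> pm.span T" "\<And>s t. s \<in> S \<Longrightarrow> t \<in> T \<Longrightarrow> s * t \<in> pm.span U"
  shows "x * y \<in> pm.span U"
  using assms(1)
proof (induction rule: pm.span_induct_alt)
  case base
  show ?case by (simp add: pm.span_zero)
next
  case (step c s x)
  have "s * y \<in> pm.span U"
    using assms(2)
  proof (induction rule: pm.span_induct_alt)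
    case base
    show ?case by (simp add: pm.span_zero)
  next
    case (step d t y)
    then show ?case
      using assms(3)[OF \<open>s \<in> S\<close>]
      by (simp add: distrib_left pm_scale_mult_right pm.span_add pm.span_scale)
  qed
  then show ?case
    using step by (simp add: distrib_right pm_scale_mult_left pm.span_add pm.span_scale)
qed

definition words_from :: "'x set \<Rightarrow> nat \<Rightarrow> 'x list set"
  where "words_from A r = {w \<in> lists A. r \<le> length w}"

lemma words_from_0 [simp]: "words_from A 0 = lists A"
  by (simp add: words_from_def)

lemma words_from_append: "u \<in> words_from A m \<Longrightarrow> v \<in> words_from A n \<Longrightarrow> u @ v \<in> words_from A (m + n)"
  by (simp add: words_from_def)

lemma span_words:
  fixes A :: "('g::monoid_add \<Rightarrow>\<^sub>0 'k::field) set"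
  assumes "generates_algebra A"
  shows "pm.span (prod_list ` lists A) = UNIV"
proof -
  let ?V = "pm.span (prod_list ` lists A)"
  have w: "prod_list w \<in> ?V" if "w \<in> lists A" for w
    using that by (simp add: pm.span_base)
  have "subalgebra ?V"
    unfolding subalgebra_def
  proof (intro conjI ballI allI)
    show "1 \<in> ?V" using w[of "[]"] by simp
  next
    fix x y assume xy: "x \<in> ?V" "y \<in> ?V"
    have "prod_list u * prod_list v \<in> ?V" if "u \<in> lists A" "v \<in> lists A" for u v
      using w[of "u @ v"] that by simp
    then show "x * y \<in> ?V"
      by (intro span_mult[OF xy]) blast
  qed (auto intro: pm.span_add pm.span_scale)
  moreover have "A \<subseteq> ?V"
    using w[of "[a]" for a] by auto
  ultimately have "subalgebra hull A \<subseteq> ?V"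
    by (metis hull_minimal)
  then show ?thesis
    using assms by (auto simp: generates_algebra_def)
qed

text \<open>
  The radical is only known to be a left ideal here, so it is the last letter that puts the word
  into it.
\<close>

lemma nonempty_word_in_jacobson_radical:
  fixes A :: "'r::ring_1 set"
  assumes "A \<subseteq> jacobson_radical" "w \<in> words_from A 1"
  shows "prod_list w \<in> jacobson_radical"
proof -
  obtain u a where w: "w = u @ [a]" and "a \<in> A"
    using assms(2) by (cases w rule: rev_cases) (auto simp: words_from_def)
  then show ?thesis
    using assms(1) left_idealD(3)[OF left_ideal_jacobson_radical] by (auto simp: subset_iff)
qed

text \<open>
  An element of the radical is a scalar plus a combination of nonempty words, which is itself in the
  radical; a nonzero scalar would put \<open>1\<close> into the radical.
\<close>

lemma jacobson_radical_eq_span_words: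
  fixes A :: "('g::monoid_add \<Rightarrow>\<^sub>0 'k::field) set"
  assumes fin: "finite (UNIV :: ('g \<Rightarrow>\<^sub>0 'k) set)"
    and gen: "generates_algebra A" and rad: "A \<subseteq> jacobson_radical"
  shows "jacobson_radical = pm.span (prod_list ` words_from A 1)"
proof (rule subset_antisym)
  let ?V = "pm.span (prod_list ` words_from A 1)"
  let ?J = "jacobson_radical :: ('g \<Rightarrow>\<^sub>0 'k) set"
  have sub: "pm.subspace ?J"
    by (rule left_ideal_subspace[OF left_ideal_jacobson_radical])
  show VJ: "?V \<subseteq> ?J"
    using nonempty_word_in_jacobson_radical[OF rad] by (intro pm.span_minimal sub) blast
  show "?J \<subseteq> ?V"
  proof
    fix x assume x: "x \<in> ?J"
    have "lists A = insert [] (words_from A 1)"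
      by (auto simp: words_from_def Suc_le_eq)
    then have "x \<in> pm.span (insert 1 (prod_list ` words_from A 1))"
      using span_words[OF gen] by (metis UNIV_I image_insert prod_list.Nil)
    then obtain c where c: "x - pm_scale c 1 \<in> ?V"
      by (auto simp: pm.span_breakdown_eq)
    with VJ have "pm_scale c 1 \<in> ?J"
      using pm.subspace_diff[OF sub x, of "x - pm_scale c 1"] by auto
    then have "pm_scale (inverse c) (pm_scale c 1) \<in> ?J"
      by (rule pm.subspace_scale[OF sub])
    moreover have "(1 :: 'g \<Rightarrow>\<^sub>0 'k) \<notin> ?J"
      by (rule one_notin_jacobson_radical[OF fin])
    ultimately have "c = 0"
      by (cases "c = 0") auto
    with c show "x \<in> ?V" by simp
  qed
qed

lemma ideal_power_eq_span_words:
  fixes A :: "('g::monoid_add \<Rightarrow>\<^sub>0 'k::field) set"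
  assumes fin: "finite (UNIV :: ('g \<Rightarrow>\<^sub>0 'k) set)"
    and gen: "generates_algebra A" and rad: "A \<subseteq> jacobson_radical"
  shows "ideal_power jacobson_radical r = pm.span (prod_list ` words_from A r)"
proof (induction r)
  case 0
  show ?case using span_words[OF gen] by simp
next
  case (Suc r)
  let ?J = "jacobson_radical :: ('g \<Rightarrow>\<^sub>0 'k) set"
  let ?V = "pm.span (prod_list ` words_from A (Suc r))"
  note J = jacobson_radical_eq_span_words[OF assms]
  have prod: "x * y \<in> ?V" if "x \<in> ?J" "y \<in> ideal_power ?J r" for x y
  proof (rule span_mult)
    show "x \<in> pm.span (prod_list ` words_from A 1)" using that J by simp
    show "y \<in> pm.span (prod_list ` words_from A r)" using that Suc by simp
  next
    fix s t assume "s \<in> prod_list ` words_from A 1" "t \<in> prod_list ` words_from A r"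
    then obtain u v where "s = prod_list u" "t = prod_list v" "u @ v \<in> words_from A (Suc r)"
      using words_from_append by fastforce
    then show "s * t \<in> ?V"
      by (metis image_eqI pm.span_base prod_list.append)
  qed
  show ?case
  proof (rule subset_antisym)
    show "ideal_power ?J (Suc r) \<subseteq> ?V"
      using prod unfolding ideal_power.simps ideal_mult_def
      by (auto intro!: pm.span_sum)
    show "?V \<subseteq> ideal_power ?J (Suc r)"
    proof (rule pm.span_minimal)
      show "pm.subspace (ideal_power ?J (Suc r))"
        by (rule left_ideal_subspace[OF left_ideal_ideal_power[OF left_ideal_jacobson_radical]])
      show "prod_list ` words_from A (Suc r) \<subseteq> ideal_power ?J (Suc r)"
      proof (clarify)
        fix w assume "w \<in> words_from A (Suc r)"
        then obtain a u where w: "w = a # u" and a: "a \<in> A" and u: "u \<in> words_from A r"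
          by (cases w) (auto simp: words_from_def)
        have "prod_list u \<in> ideal_power ?J r"
          unfolding Suc using u by (simp add: pm.span_base)
        then show "prod_list w \<in> ideal_power ?J (Suc r)"
          using a rad by (auto simp: w intro: ideal_mult_prod)
      qed
    qed
  qed
qed


section \<open>Independence of nontips and rewriting of tips\<close>

lemma natural_map_sum: "natural_map (sum f T) = (\<Sum>w\<in>T. natural_map (f w))"
proof (induction T rule: infinite_finite_induct)
  case (insert x F)
  then show ?case by (simp add: natural_map_add)
qed (simp_all add: natural_map_def)

text \<open>
  The largest word of a nonzero relation among nontips would be a tip. Relations are taken in the
  free algebra, where distinct words stay distinct even if their images agree, so that this gives
  injectivity on the nontips along with independence of their images.
\<close>

lemma relation_among_nontips_trivial:
  assumes ord: "reflp_on (lists A) leq" "transp_on (lists A) leq" "totalp_on (lists A) leq"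
    and keys: "Poly_Mapping.keys P \<subseteq> nontips leq A" and zero: "natural_map P = 0"
  shows "P = 0"
proof (rule ccontr)
  assume "P \<noteq> 0"
  moreover have lists: "Poly_Mapping.keys P \<subseteq> lists A"
    using keys by (auto simp: nontips_def)
  ultimately obtain m where m: "m \<in> Poly_Mapping.keys P" "\<forall>v\<in>Poly_Mapping.keys P. leq v m"
    using Finite_Set.bex_greatest_element[of "Poly_Mapping.keys P" leq]
      reflp_on_subset[OF ord(1) lists] transp_on_subset[OF ord(2) lists]
      totalp_on_subset[OF ord(3) lists]
    by (metis finite_keys keys_eq_empty reflp_onD)
  have "P \<in> relation_ideal A"
    using lists zero by (simp add: relation_ideal_def free_algebra_def)
  then have "m \<in> tips leq A"
    using m \<open>P \<noteq> 0\<close> by (auto simp: tips_def)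
  then show False
    using m(1) keys by (auto simp: nontips_def)
qed

lemma nontips_independent:
  fixes A :: "('g::monoid_add \<Rightarrow>\<^sub>0 'k::field) set"
  assumes ord: "reflp_on (lists A) leq" "transp_on (lists A) leq" "totalp_on (lists A) leq"
  shows "inj_on prod_list (nontips leq A)" "pm.independent (prod_list ` nontips leq A)"
proof -
  show inj: "inj_on prod_list (nontips leq A)"
  proof (rule inj_onI, rule ccontr)
    fix u v
    assume uv: "u \<in> nontips leq A" "v \<in> nontips leq A" "prod_list u = prod_list v" "u \<noteq> v"
    let ?P = "Poly_Mapping.single u (1::'k) + Poly_Mapping.single v (-1)"
    have "Poly_Mapping.keys ?P \<subseteq> nontips leq A"
      using keys_add[of "Poly_Mapping.single u (1::'k)" "Poly_Mapping.single v (-1)"] uv(1,2)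
      by (auto split: if_splits)
    moreover have "natural_map ?P = 0"
      using uv(3) by (simp add: natural_map_add natural_map_single flip: pm.scale_left_distrib)
    ultimately have "?P = 0"
      by (rule relation_among_nontips_trivial[OF ord])
    moreover have "Poly_Mapping.lookup ?P u = 1"
      using uv(4) by (simp add: lookup_add lookup_single when_def)
    ultimately show False by simp
  qed
  show "pm.independent (prod_list ` nontips leq A)"
  proof
    assume "pm.dependent (prod_list ` nontips leq A)"
    then obtain U c x where U: "finite U" "U \<subseteq> prod_list ` nontips leq A"
      "(\<Sum>v\<in>U. pm_scale (c v) v) = 0" "x \<in> U" "c x \<noteq> 0"
      unfolding pm.dependent_explicit by blast
    obtain T where T: "T \<subseteq> nontips leq A" "finite T" "U = prod_list ` T"
      using finite_subset_image[OF U(1,2)] by blast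
    define P where "P = (\<Sum>w\<in>T. Poly_Mapping.single w (c (prod_list w)))"
    have lookup: "Poly_Mapping.lookup P w = (if w \<in> T then c (prod_list w) else 0)" for w
      using T(2) by (simp add: P_def lookup_sum lookup_single when_def)
    have "Poly_Mapping.keys P \<subseteq> nontips leq A"
      using T(1) by (auto simp: in_keys_iff lookup split: if_splits)
    moreover have "natural_map P = (\<Sum>w\<in>T. pm_scale (c (prod_list w)) (prod_list w))"
      by (simp add: P_def natural_map_sum natural_map_single)
    then have "natural_map P = 0"
      using U(3) inj_on_subset[OF inj T(1)] by (simp add: T(3) sum.reindex)
    ultimately have "P = 0"
      by (rule relation_among_nontips_trivial[OF ord])
    moreover obtain w where "w \<in> T" "x = prod_list w"
      using U(4) T(3) by blast
    ultimately show False
      using lookup[of w] U(5) by simp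
  qed
qed

text \<open>
  The coefficient of the largest word in a relation is nonzero, so the relation can be solved for
  that word.
\<close>

lemma tip_in_span_smaller:
  fixes A :: "('g::monoid_add \<Rightarrow>\<^sub>0 'k::field) set"
  assumes "w \<in> tips leq A"
  shows "prod_list w \<in> pm.span (prod_list ` {v \<in> lists A. leq v w \<and> v \<noteq> w})"
proof -
  let ?V = "pm.span (prod_list ` {v \<in> lists A. leq v w \<and> v \<noteq> w})"
  obtain P where P: "P \<in> relation_ideal A" "w \<in> Poly_Mapping.keys P"
      "\<forall>v\<in>Poly_Mapping.keys P. leq v w"
    using assms by (auto simp: tips_def)
  have keys: "Poly_Mapping.keys P \<subseteq> lists A" and zero: "natural_map P = 0"
    using P(1) by (auto simp: relation_ideal_def free_algebra_def)
  let ?c = "Poly_Mapping.lookup P"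
  let ?s = "\<Sum>v\<in>Poly_Mapping.keys P - {w}. pm_scale (?c v) (prod_list v)"
  have "pm_scale (?c w) (prod_list w) + ?s = 0"
    using zero P(2) unfolding natural_map_def by (simp add: sum.remove)
  then have "pm_scale (?c w) (prod_list w) = - ?s"
    by (simp add: eq_neg_iff_add_eq_0)
  moreover have "?s \<in> ?V"
    using P(3) keys by (intro pm.span_sum pm.span_scale pm.span_base) auto
  ultimately have "pm_scale (?c w) (prod_list w) \<in> ?V"
    by (simp add: pm.span_neg)
  then have "pm_scale (inverse (?c w)) (pm_scale (?c w) (prod_list w)) \<in> ?V"
    by (rule pm.span_scale)
  then show ?thesis
    using P(2) by (simp add: in_keys_iff)
qed


section \<open>The reverse length-lexicographical ordering\<close>

lemma lexord_total_on_lists: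
  assumes "total_on A S" "u \<in> lists A" "v \<in> lists A" "u \<noteq> v"
  shows "(u, v) \<in> lexord S \<or> (v, u) \<in> lexord S"
  using assms(2-4)
proof (induction u arbitrary: v rule: list.induct)
  case Nil
  then show ?case by (cases v) auto
next
  case (Cons a u)
  note IH = Cons.IH and prems = Cons.prems
  show ?case
  proof (cases v)
    case (Cons b v')
    have "(a, b) \<in> S \<or> (b, a) \<in> S" if "a \<noteq> b"
      using assms(1)[unfolded total_on_def, rule_format, of a b] prems that Cons by simp
    then show ?thesis
      using IH[of v'] prems Cons by auto
  qed simp
qed

lemma RLL_le_linear:
  assumes R: "linear_order_on A R"
  shows "reflp (RLL_le R)" "transp (RLL_le R)" "antisymp (RLL_le R)" "totalp_on (lists A) (RLL_le R)"
proof -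
  have tr: "trans (R - Id)" and tot: "total_on A (R - Id)"
    using R by (auto simp: order_on_defs intro: trans_diff_Id)
  have irr: "(u, u) \<notin> lexord (R - Id)" for u
    by (rule lexord_irreflexive) simp
  have lex_trans: "lex_le R u w" if "lex_le R u v" "lex_le R v w" for u v w
    using that lexord_trans[OF _ _ tr] by (auto simp: lex_le_def)
  have lex_antisym: "u = v" if "lex_le R u v" "lex_le R v u" for u v
    using that lexord_trans[OF _ _ tr, of u v u] irr by (auto simp: lex_le_def)
  show "reflp (RLL_le R)"
    by (auto intro!: reflpI simp: RLL_le_def LL_le_def lex_le_def)
  show "transp (RLL_le R)"
    by (auto intro!: transpI simp: RLL_le_def LL_le_def intro: lex_trans)
  show "antisymp (RLL_le R)"
    by (auto intro!: antisympI simp: RLL_le_def LL_le_def intro: lex_antisym)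
  show "totalp_on (lists A) (RLL_le R)"
  proof (rule totalp_onI)
    fix u v assume "u \<in> lists A" "v \<in> lists A" "u \<noteq> v"
    then show "RLL_le R u v \<or> RLL_le R v u"
      using lexord_total_on_lists[OF tot, of u v]
      by (auto simp: RLL_le_def LL_le_def lex_le_def)
  qed
qed

text \<open>
  Rewriting a tip replaces it by smaller words, and the ordering may have infinite descending chains. As
  the words of length at least \<open>N\<close> vanish, it is enough to count the words below \<open>w\<close> that are
  shorter than \<open>N\<close>: their number is finite and drops with each rewriting of a word shorter than \<open>N\<close>.
\<close>

lemma word_in_span_nontips:
  fixes A :: "('g::monoid_add \<Rightarrow>\<^sub>0 'k::field) set"
  assumes R: "linear_order_on A R" and fin: "finite A"
    and vanish: "\<And>w. w \<in> words_from A N \<Longrightarrow> prod_list w = 0"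
    and w: "w \<in> words_from A r"
  shows "prod_list w \<in> pm.span (prod_list ` {w \<in> nontips (RLL_le R) A. r \<le> length w})"
proof -
  let ?le = "RLL_le R"
  let ?V = "pm.span (prod_list ` {w \<in> nontips ?le A. r \<le> length w})"
  define below where "below w = {v \<in> lists A. length v < N \<and> ?le v w}" for w
  note ord = RLL_le_linear[OF R]
  have finite_below: "finite (below w)" for w
    by (rule finite_subset[OF _ finite_lists_length_le[OF fin, of N]]) (auto simp: below_def)
  show ?thesis
    using w
  proof (induction "card (below w)" arbitrary: w rule: less_induct)
    case less
    have w: "w \<in> lists A" "r \<le> length w"
      using less.prems by (auto simp: words_from_def)
    consider "N \<le> length w" | "w \<in> nontips ?le A" | "length w < N" "w \<in> tips ?le A"
      using w by (force simp: nontips_def)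
    then show ?case
    proof cases
      case 1
      then show ?thesis
        using vanish[of w] w by (simp add: words_from_def pm.span_zero)
    next
      case 2
      then show ?thesis using w by (auto intro: pm.span_base)
    next
      case 3
      have "prod_list v \<in> ?V" if v: "v \<in> lists A" "?le v w" "v \<noteq> w" for v
      proof (rule less.hyps)
        have "below v \<subseteq> below w"
          using v(2) ord(2) by (auto simp: below_def dest: transpD)
        moreover have "w \<in> below w"
          using w 3(1) ord(1) by (auto simp: below_def dest: reflpD)
        moreover have "w \<notin> below v"
          using v ord(3) by (auto simp: below_def dest: antisympD)
        ultimately show "card (below v) < card (below w)"
          by (intro psubset_card_mono finite_below) blast
        show "v \<in> words_from A r"
          using v w by (auto simp: words_from_def RLL_le_def LL_le_def)
      qed
      then have "pm.span (prod_list ` {v \<in> lists A. ?le v w \<and> v \<noteq> w}) \<subseteq> ?V"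
        by (intro pm.span_minimal) auto
      then show ?thesis
        using tip_in_span_smaller[OF 3(2)] by blast
    qed
  qed
qed


section \<open>Bases of the powers of the radical\<close>

text \<open>
  An element in both spans has two expansions in the independent family, one supported on each part;
  by uniqueness both are zero.
\<close>

lemma span_Int_disjoint:
  fixes B C :: "('x \<Rightarrow>\<^sub>0 'k::field) set"
  assumes ind: "pm.independent (B \<union> C)" and "B \<inter> C = {}"
  shows "pm.span B \<inter> pm.span C = {0}"
proof -
  have "x = 0" if "x \<in> pm.span B" "x \<in> pm.span C" for x
  proof -
    have B: "pm.representation (B \<union> C) x = pm.representation B x"
      and C: "pm.representation (B \<union> C) x = pm.representation C x"
      using that ind by (auto intro!: pm.representation_extend)
    have none: "pm.representation C x b = 0" for b
      using pm.representation_ne_zero[of B x b] pm.representation_ne_zero[of C x b] B C assms(2)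
      by force
    have "pm.independent C"
      using ind by (rule pm.independent_mono) simp
    from pm.sum_nonzero_representation_eq[OF this that(2)] show ?thesis
      by (simp add: none)
  qed
  then show ?thesis by (auto simp: pm.span_zero)
qed

theorem lemma2p4:
  fixes A :: "('g::{finite, group_add} \<Rightarrow>\<^sub>0 'p::prime_card mod_ring) set"
    and R :: "(('g \<Rightarrow>\<^sub>0 'p mod_ring) \<times> ('g \<Rightarrow>\<^sub>0 'p mod_ring)) set"
    and r :: nat
  assumes p_group: "\<exists>n. CARD('g) = CARD('p) ^ n"
    and "finite A"
    and "linear_order_on A R"
    and "generates_algebra A"
    and "A \<subseteq> jacobson_radical"
  shows "words_basis {w \<in> nontips (RLL_le R) A. length w \<ge> r} (ideal_power jacobson_radical r) \<and>
    (\<exists>C. complement_in C (ideal_power jacobson_radical (Suc r)) (ideal_power jacobson_radical r) \<and>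
         words_basis {w \<in> nontips (RLL_le R) A. length w = r} C)"
proof -
  let ?N = "nontips (RLL_le R) A"
  let ?J = "jacobson_radical :: ('g \<Rightarrow>\<^sub>0 'p mod_ring) set"
  define From where "From r = {w \<in> ?N. r \<le> length w}" for r
  define At where "At = {w \<in> ?N. length w = r}"
  note ord = RLL_le_linear[OF assms(3)]
  have inj: "inj_on prod_list ?N" and ind: "pm.independent (prod_list ` ?N)"
    using nontips_independent[of A "RLL_le R"] ord
    by (auto intro: reflp_on_subset transp_on_subset)
  have fin: "finite (UNIV :: ('g \<Rightarrow>\<^sub>0 'p mod_ring) set)"
    by (rule finite_UNIV_poly_mapping)
  note power = ideal_power_eq_span_words[OF fin assms(4,5)]
  obtain N where N: "ideal_power ?J N = {0}"
    using jacobson_radical_nilpotent[OF fin] by blast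
  have vanish: "prod_list w = 0" if "w \<in> words_from A N" for w
    using that N power[of N] by (metis image_eqI pm.span_base singletonD)
  have span: "pm.span (prod_list ` From s) = ideal_power ?J s" for s
    unfolding power From_def
  proof (rule subset_antisym)
    show "pm.span (prod_list ` {w \<in> ?N. s \<le> length w}) \<subseteq> pm.span (prod_list ` words_from A s)"
      by (intro pm.span_mono image_mono) (auto simp: words_from_def nontips_def)
    show "pm.span (prod_list ` words_from A s) \<subseteq> pm.span (prod_list ` {w \<in> ?N. s \<le> length w})"
      using word_in_span_nontips[OF assms(3,2) vanish]
      by (intro pm.span_minimal) auto
  qed
  have basis: "words_basis X (pm.span (prod_list ` X))" if "X \<subseteq> ?N" for X
    unfolding words_basis_def
    using inj_on_subset[OF inj that] pm.independent_mono[OF ind image_mono[OF that]] by simp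
  have sub: "From r \<subseteq> ?N" "From (Suc r) \<subseteq> ?N" "At \<subseteq> ?N"
    by (auto simp: From_def At_def)
  have split: "From r = At \<union> From (Suc r)" and disj: "At \<inter> From (Suc r) = {}"
    by (auto simp: From_def At_def)
  have "pm.independent (prod_list ` At \<union> prod_list ` From (Suc r))"
    using pm.independent_mono[OF ind image_mono[OF sub(1)]] unfolding split image_Un .
  moreover have "prod_list ` At \<inter> prod_list ` From (Suc r) = {}"
    using disj inj_on_image_Int[OF inj sub(3,2)] by simp
  ultimately have "pm.span (prod_list ` At) \<inter> pm.span (prod_list ` From (Suc r)) = {0}"
    by (rule span_Int_disjoint)
  moreover have sum: "pm.span (prod_list ` From r) =
      {c + u | c u. c \<in> pm.span (prod_list ` At) \<and> u \<in> pm.span (prod_list ` From (Suc r))}"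
    unfolding split image_Un pm.span_Un ..
  moreover have "pm.span (prod_list ` At) \<subseteq> pm.span (prod_list ` From r)"
    unfolding split by (intro pm.span_mono) auto
  ultimately have "complement_in (pm.span (prod_list ` At)) (ideal_power ?J (Suc r)) (ideal_power ?J r)"
    unfolding complement_in_def span by (intro conjI pm.subspace_span)
  moreover have "words_basis (From r) (ideal_power ?J r)"
    using basis[OF sub(1)] unfolding span .
  ultimately show ?thesis
    using basis[OF sub(3)] unfolding From_def At_def by (intro conjI exI)
qed

end
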